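(* Let $f\in\mathbf{Q}_V(\bar k)$ correspond to the reciprocal map $r:V\setminus\{0\}\to\bar k$, and let $\{0\}\ne V'\subset V$ be a subspace. Then $f\in\mathcal{Q}_{V'}(\bar k)$ if and only if for all $v\in V\setminus\{0\}$: $$r(v)=0\iff v\in V\setminus V'.$$
   Context: Let $k$ be a finite field, $\bar k$ an algebraic closure, $V$ a $k$-vector space of dimension $n+1\ge2$. $\mathbf{Q}_V=\mathrm{Proj}\,k[\frac1v\mid v\in V\setminus\{0\}]$, where the ring is a subalgebra of $\mathrm{Frac}(\mathrm{Sym}\,V)$ graded by $\deg\frac1v=1$. A map $r:V\setminus\{0\}\to\bar k$ is reciprocal if $r(\lambda v)=\lambda^{-1}r(v)$ for all $v\in V\setminus\{0\}$, $\lambda\in k^\times$, and $r(v)r(v')=r(v+v')(r(v)+r(v'))$ for all $v,v'\in V\setminus\{0\}$ with $v+v'\ne0$. The $\bar k$-points of $\mathbf{Q}_V$ correspond to the not identically zero reciprocal maps up to $\bar k^\times$ (via $\frac1v\mapsto r(v)$). For $\{0\}\ne W\subset V$, $\mathbf{Q}_W\subset\mathbf{Q}_V$ is the closed subscheme defined by the homogeneous ideal $(\frac1v\mid v\in V\setminus W)$, and $\mathcal{Q}_{V'}=\mathbf{Q}_{V'}\setminus\bigcup_{\{0\}\ne W\subsetneq V'}\mathbf{Q}_W$. *)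

theory Defs
  imports
    "HOL-Library.Poly_Mapping"
    "HOL-Library.FuncSet"
    "HOL-Computational_Algebra.Fraction_Field"
    "HOL-Algebra.Generated_Rings"
    "HOL-Algebra.Algebraic_Closure_Type"
begin

section \<open>Proj of a graded subring of a field, and its points over a field\<close>

abbreviation subring_of_field :: "'a::field set \<Rightarrow> 'a ring" where
  "subring_of_field A \<equiv> ring_of_type_algebra\<lparr>carrier := A\<rparr>"

text \<open>Below, \<open>A\<close> is a subring of a field and \<open>G d\<close> is its homogeneous part of degree \<open>d\<close>.\<close>

definition homogeneous_ideal :: "'a::field set \<Rightarrow> (nat \<Rightarrow> 'a set) \<Rightarrow> 'a set \<Rightarrow> bool" where
  "homogeneous_ideal A G I \<longleftrightarrow>
     ideal I (subring_of_field A) \<and> I = Idl\<^bsub>subring_of_field A\<^esub> (I \<inter> (\<Union>d. G d))"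

definition Proj :: "'a::field set \<Rightarrow> (nat \<Rightarrow> 'a set) \<Rightarrow> 'a set set" where
  "Proj A G = {p. primeideal p (subring_of_field A) \<and> homogeneous_ideal A G p \<and>
                  \<not> (\<Union>d\<in>{1..}. G d) \<subseteq> p}"

text \<open>The stalk of the structure sheaf at \<open>p\<close> is the degree 0 part of the homogeneous
  localization at \<open>p\<close>. As \<open>A\<close> lies in a field, it can be formed inside that field.\<close>

definition Proj_stalk :: "(nat \<Rightarrow> 'a::field set) \<Rightarrow> 'a set \<Rightarrow> 'a set" where
  "Proj_stalk G p = {a / b | a b d. a \<in> G d \<and> b \<in> G d \<and> b \<notin> p}"

definition Proj_stalk_max :: "(nat \<Rightarrow> 'a::field set) \<Rightarrow> 'a set \<Rightarrow> 'a set" where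
  "Proj_stalk_max G p = {a / b | a b d. a \<in> G d \<and> a \<in> p \<and> b \<in> G d \<and> b \<notin> p}"

text \<open>Let \<open>\<kappa>\<close> make \<open>A\<close> a \<open>k\<close>-algebra and \<open>\<iota>\<close> make the field \<open>'l\<close> an extension of \<open>k\<close>.
  A morphism of \<open>k\<close>-schemes from the spectrum of \<open>'l\<close> to a scheme \<open>X\<close> is a point \<open>p\<close> of \<open>X\<close>
  together with a local homomorphism of \<open>k\<close>-algebras from the stalk at \<open>p\<close> to \<open>'l\<close>.\<close>

definition Proj_points ::
  "'a::field set \<Rightarrow> (nat \<Rightarrow> 'a set) \<Rightarrow> ('k \<Rightarrow> 'a) \<Rightarrow> ('k \<Rightarrow> 'l::field) \<Rightarrow> ('a set \<times> ('a \<Rightarrow> 'l)) set" where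
  "Proj_points A G \<kappa> \<iota> = {(p, \<phi>). p \<in> Proj A G \<and>
     \<phi> \<in> extensional (Proj_stalk G p) \<and>
     \<phi> \<in> ring_hom (subring_of_field (Proj_stalk G p)) ring_of_type_algebra \<and>
     (\<forall>c. \<phi> (\<kappa> c) = \<iota> c) \<and>
     (\<forall>x\<in>Proj_stalk G p. \<phi> x = 0 \<longleftrightarrow> x \<in> Proj_stalk_max G p)}"

text \<open>Since \<open>'l\<close> is a field, an \<open>'l\<close>-point of Proj factors through the closed subscheme defined by
  a homogeneous ideal \<open>I\<close> iff its underlying point \<open>p\<close> lies in the vanishing locus of \<open>I\<close>.\<close>

definition closed_subscheme_points ::
  "'a::field set \<Rightarrow> (nat \<Rightarrow> 'a set) \<Rightarrow> ('k \<Rightarrow> 'a) \<Rightarrow> ('k \<Rightarrow> 'l::field) \<Rightarrow> 'a set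
     \<Rightarrow> ('a set \<times> ('a \<Rightarrow> 'l)) set" where
  "closed_subscheme_points A G \<kappa> \<iota> I = {(p, \<phi>) \<in> Proj_points A G \<kappa> \<iota>. I \<subseteq> p}"


section \<open>The fraction field of the symmetric algebra\<close>

text \<open>For a basis \<open>b 0, \<dots>, b n\<close> of \<open>V\<close>, the symmetric algebra of \<open>V\<close> is the polynomial ring over
  \<open>k\<close> in \<open>X 0, \<dots>, X n\<close>, with \<open>b i\<close> corresponding to \<open>X i\<close>. We work in the rational function field
  in all variables \<open>X i\<close>, \<open>i :: nat\<close>; only those with \<open>i \<le> n\<close> occur in the elements used below.\<close>

type_synonym 'k ratfun = "((nat \<Rightarrow>\<^sub>0 nat) \<Rightarrow>\<^sub>0 'k) fract"

definition ordered_basis ::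
  "('k::field \<Rightarrow> 'v::ab_group_add \<Rightarrow> 'v) \<Rightarrow> nat \<Rightarrow> (nat \<Rightarrow> 'v) \<Rightarrow> bool" where
  "ordered_basis scale n b \<longleftrightarrow> inj_on b {..n} \<and>
     \<not> Modules.module.dependent scale (b ` {..n}) \<and>
     Modules.module.span scale (b ` {..n}) = UNIV"

definition ratfun_const :: "'k::field \<Rightarrow> 'k ratfun" where
  "ratfun_const c = Fract (Poly_Mapping.single 0 c) 1"

definition Sym_embed ::
  "('k::field \<Rightarrow> 'v::ab_group_add \<Rightarrow> 'v) \<Rightarrow> nat \<Rightarrow> (nat \<Rightarrow> 'v) \<Rightarrow> 'v \<Rightarrow> 'k ratfun" where
  "Sym_embed scale n b v =
     Fract (\<Sum>i\<le>n. Poly_Mapping.single (Poly_Mapping.single i 1)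
                    (Modules.module.representation scale (b ` {..n}) v (b i))) 1"

abbreviation recip ::
  "('k::field \<Rightarrow> 'v::ab_group_add \<Rightarrow> 'v) \<Rightarrow> nat \<Rightarrow> (nat \<Rightarrow> 'v) \<Rightarrow> 'v \<Rightarrow> 'k ratfun" where
  "recip scale n b v \<equiv> 1 / Sym_embed scale n b v"


section \<open>The scheme \<open>Q_V\<close> and its strata\<close>

definition R_V ::
  "('k::field \<Rightarrow> 'v::ab_group_add \<Rightarrow> 'v) \<Rightarrow> nat \<Rightarrow> (nat \<Rightarrow> 'v) \<Rightarrow> 'k ratfun set" where
  "R_V scale n b =
     generate_ring ring_of_type_algebra (range ratfun_const \<union> recip scale n b ` (- {0}))"

definition R_V_deg ::
  "('k::field \<Rightarrow> 'v::ab_group_add \<Rightarrow> 'v) \<Rightarrow> nat \<Rightarrow> (nat \<Rightarrow> 'v) \<Rightarrow> nat \<Rightarrow> 'k ratfun set" where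
  "R_V_deg scale n b d =
     Modules.module.span (\<lambda>c x. ratfun_const c * x)
       {prod_list (map (recip scale n b) vs) | vs. length vs = d \<and> set vs \<subseteq> - {0}}"

definition Q_V_points ::
  "('k::field \<Rightarrow> 'v::ab_group_add \<Rightarrow> 'v) \<Rightarrow> nat \<Rightarrow> (nat \<Rightarrow> 'v) \<Rightarrow> ('k \<Rightarrow> 'l::field)
     \<Rightarrow> ('k ratfun set \<times> ('k ratfun \<Rightarrow> 'l)) set" where
  "Q_V_points scale n b \<iota> = Proj_points (R_V scale n b) (R_V_deg scale n b) ratfun_const \<iota>"

definition Q_ideal ::
  "('k::field \<Rightarrow> 'v::ab_group_add \<Rightarrow> 'v) \<Rightarrow> nat \<Rightarrow> (nat \<Rightarrow> 'v) \<Rightarrow> 'v set \<Rightarrow> 'k ratfun set" where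
  "Q_ideal scale n b W = Idl\<^bsub>subring_of_field (R_V scale n b)\<^esub> (recip scale n b ` (UNIV - W))"

definition Q_sub_points ::
  "('k::field \<Rightarrow> 'v::ab_group_add \<Rightarrow> 'v) \<Rightarrow> nat \<Rightarrow> (nat \<Rightarrow> 'v) \<Rightarrow> ('k \<Rightarrow> 'l::field) \<Rightarrow> 'v set
     \<Rightarrow> ('k ratfun set \<times> ('k ratfun \<Rightarrow> 'l)) set" where
  "Q_sub_points scale n b \<iota> W =
     closed_subscheme_points (R_V scale n b) (R_V_deg scale n b) ratfun_const \<iota>
       (Q_ideal scale n b W)"

definition Q_stratum_points ::
  "('k::field \<Rightarrow> 'v::ab_group_add \<Rightarrow> 'v) \<Rightarrow> nat \<Rightarrow> (nat \<Rightarrow> 'v) \<Rightarrow> ('k \<Rightarrow> 'l::field) \<Rightarrow> 'v set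
     \<Rightarrow> ('k ratfun set \<times> ('k ratfun \<Rightarrow> 'l)) set" where
  "Q_stratum_points scale n b \<iota> V' = Q_sub_points scale n b \<iota> V' -
     (\<Union>W\<in>{W. Modules.module.subspace scale W \<and> W \<noteq> {0} \<and> W \<subset> V'}. Q_sub_points scale n b \<iota> W)"


section \<open>Reciprocal maps\<close>

text \<open>A reciprocal map is only defined on nonzero vectors; the value at \<open>0\<close> is never used.\<close>

definition reciprocal_map ::
  "('k::field \<Rightarrow> 'v::ab_group_add \<Rightarrow> 'v) \<Rightarrow> ('k \<Rightarrow> 'l::field) \<Rightarrow> ('v \<Rightarrow> 'l) \<Rightarrow> bool" where
  "reciprocal_map scale \<iota> r \<longleftrightarrow>
     (\<forall>v c. v \<noteq> 0 \<longrightarrow> c \<noteq> 0 \<longrightarrow> r (scale c v) = \<iota> (inverse c) * r v) \<and>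
     (\<forall>v v'. v \<noteq> 0 \<longrightarrow> v' \<noteq> 0 \<longrightarrow> v + v' \<noteq> 0 \<longrightarrow> r v * r v' = r (v + v') * (r v + r v'))"

text \<open>The point \<open>(p, \<phi>)\<close> is the one induced by the \<open>k\<close>-algebra homomorphism \<open>\<psi>\<close> that sends
  \<open>1/v\<close> to \<open>r v\<close>: on each stalk element \<open>a/b\<close>, \<open>\<phi>\<close> is \<open>\<psi> a / \<psi> b\<close>. Rescaling \<open>r\<close> by a
  nonzero constant does not change the point.\<close>

definition corresponds_to ::
  "('k::field \<Rightarrow> 'v::ab_group_add \<Rightarrow> 'v) \<Rightarrow> nat \<Rightarrow> (nat \<Rightarrow> 'v) \<Rightarrow> ('k \<Rightarrow> 'l::field)
     \<Rightarrow> 'k ratfun set \<times> ('k ratfun \<Rightarrow> 'l) \<Rightarrow> ('v \<Rightarrow> 'l) \<Rightarrow> bool" where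
  "corresponds_to scale n b \<iota> f r \<longleftrightarrow> (case f of (p, \<phi>) \<Rightarrow>
     \<exists>\<psi>. \<psi> \<in> ring_hom (subring_of_field (R_V scale n b)) ring_of_type_algebra \<and>
         (\<forall>c. \<psi> (ratfun_const c) = \<iota> c) \<and>
         (\<forall>v. v \<noteq> 0 \<longrightarrow> \<psi> (recip scale n b v) = r v) \<and>
         (\<forall>d. \<forall>x\<in>R_V_deg scale n b d. \<forall>y\<in>R_V_deg scale n b d - p.
            \<psi> y \<noteq> 0 \<and> \<phi> (x / y) = \<psi> x / \<psi> y))"

end

theory Submission
  imports Defs
begin

text \<open>Homogeneity identifies the vanishing of \<open>r v\<close> with \<open>1/v\<close> lying in the prime \<open>p\<close> of the
  point, so the point lies in \<open>Q_W\<close> iff the support of \<open>r\<close> is contained in \<open>W\<close>. The reciprocal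
  relations make the support of \<open>r\<close>, together with \<open>0\<close>, a subspace. Hence it is the least \<open>W\<close> with
  the point in \<open>Q_W\<close>, and the point lies in the stratum of exactly this subspace.\<close>

lemma ratfun_const_add: "ratfun_const (c + d) = ratfun_const c + ratfun_const d"
  by (simp add: ratfun_const_def single_add)

lemma ratfun_const_mult: "ratfun_const (c * d) = ratfun_const c * ratfun_const d"
  by (simp add: ratfun_const_def mult_single)

lemma ratfun_const_1: "ratfun_const 1 = 1"
  by (simp add: ratfun_const_def One_fract_def)

text \<open>Needed for span facts about \<open>R_V_deg\<close>, where \<open>k\<close> acts through
  \<open>ratfun_const\<close>.\<close>

lemma module_ratfun: "Modules.module (\<lambda>c x. ratfun_const c * x)"
  by unfold_locales
    (simp_all add: ratfun_const_add ratfun_const_mult ratfun_const_1 algebra_simps)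

lemma recip_power_in_R_V_deg:
  assumes "v \<noteq> 0"
  shows "recip scale n b v ^ d \<in> R_V_deg scale n b d"
  unfolding R_V_deg_def
  using assms
  by (intro Modules.module.span_base[OF module_ratfun] CollectI exI[of _ "replicate d v"])
    (auto simp: prod_list_replicate)

text \<open>The induction starts at exponent 1, since \<open>x ^ 0 = 1\<close> lies in no proper
  ideal.\<close>

lemma power_in_ideal_of_field:
  assumes "ideal p (subring_of_field A)" "x \<in> p" "d > 0"
  shows "x ^ d \<in> p"
  using \<open>d > 0\<close>
proof (induction d rule: nat_induct_non_zero)
  case 1
  then show ?case using assms by simp
next
  case (Suc d)
  interpret ideal p "subring_of_field A" by fact
  have "x \<in> A" using \<open>x \<in> p\<close> a_subset by auto
  with Suc I_l_closed[of "x ^ d" x] show ?case by (simp add: ring_of_type_algebra_def)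
qed

text \<open>All these powers stay in the ideal \<open>p\<close>, hence in the carrier
  \<open>A\<close>, where \<open>\<psi>\<close> is known to be multiplicative.\<close>

lemma ring_hom_power_of_field:
  assumes "ideal p (subring_of_field A)" "\<psi> \<in> ring_hom (subring_of_field A) ring_of_type_algebra"
    and "x \<in> p" "d > 0"
  shows "\<psi> (x ^ d) = \<psi> x ^ d"
  using \<open>d > 0\<close>
proof (induction d rule: nat_induct_non_zero)
  case 1
  then show ?case by simp
next
  case (Suc d)
  interpret ideal p "subring_of_field A" by fact
  have "x \<in> A" "x ^ d \<in> A"
    using \<open>x \<in> p\<close> power_in_ideal_of_field[OF assms(1,3)] Suc a_subset by auto
  with Suc ring_hom_mult[OF assms(2), of x "x ^ d"] show ?case
    by (simp add: ring_of_type_algebra_def)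
qed

lemma recip_in_point_iff:
  assumes pt: "(p, \<phi>) \<in> Q_V_points scale n b \<iota>"
    and r: "corresponds_to scale n b \<iota> (p, \<phi>) r"
    and v: "v \<noteq> 0"
  shows "recip scale n b v \<in> p \<longleftrightarrow> r v = 0"
proof -
  let ?G = "R_V_deg scale n b" and ?x = "recip scale n b v"
  obtain \<psi> where hom: "\<psi> \<in> ring_hom (subring_of_field (R_V scale n b)) ring_of_type_algebra"
    and \<psi>_recip: "\<psi> ?x = r v"
    and \<psi>_nz: "\<And>d y. y \<in> ?G d - p \<Longrightarrow> \<psi> y \<noteq> 0"
    and \<phi>_eq: "\<And>d x y. x \<in> ?G d \<Longrightarrow> y \<in> ?G d - p \<Longrightarrow> \<phi> (x / y) = \<psi> x / \<psi> y"
    using r v unfolding corresponds_to_def by fast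
  have Proj: "p \<in> Proj (R_V scale n b) ?G"
    and \<phi>_0: "\<And>z. z \<in> Proj_stalk_max ?G p \<Longrightarrow> z \<in> Proj_stalk ?G p \<Longrightarrow> \<phi> z = 0"
    using pt unfolding Q_V_points_def Proj_points_def by auto
  have ideal: "ideal p (subring_of_field (R_V scale n b))"
    using Proj unfolding Proj_def by (auto intro: primeideal.axioms(1))
  show ?thesis
  proof
    assume "?x \<in> p"
    \<comment> \<open>As \<open>p\<close> does not contain the irrelevant ideal, some homogeneous
      \<open>y\<close> of positive degree \<open>d\<close> can serve as a denominator. Its degree
      need not be 1, so the numerator has to be the \<open>d\<close>-th power of
      \<open>1/v\<close>.\<close>
    have "\<not> (\<Union>d\<in>{1..}. ?G d) \<subseteq> p"
      using Proj unfolding Proj_def by blast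
    then obtain d y where "d \<in> {1..}" and y: "y \<in> ?G d" "y \<notin> p"
      by blast
    then have d: "d > 0"
      by simp
    have x: "?x ^ d \<in> ?G d" "?x ^ d \<in> p"
      using recip_power_in_R_V_deg[OF v] power_in_ideal_of_field[OF ideal \<open>?x \<in> p\<close> d] by blast+
    \<comment> \<open>The fraction lies in the maximal ideal of the stalk at \<open>p\<close>, which
      the local homomorphism \<open>\<phi>\<close> kills.\<close>
    have "\<phi> (?x ^ d / y) = 0"
      using x y by (intro \<phi>_0) (unfold Proj_stalk_def Proj_stalk_max_def, blast+)
    moreover have "\<phi> (?x ^ d / y) = r v ^ d / \<psi> y"
      using \<phi>_eq[of "?x ^ d" d y] x y ring_hom_power_of_field[OF ideal hom \<open>?x \<in> p\<close> d] \<psi>_recip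
      by simp
    ultimately show "r v = 0"
      using \<psi>_nz[of y d] y by simp
  next
    assume "r v = 0"
    then show "?x \<in> p"
      \<comment> \<open>Outside \<open>p\<close>, the degree 1 element \<open>1/v\<close> would be
        an admissible denominator, so \<open>\<psi>\<close> could not send it to 0.\<close>
      using \<psi>_nz[of ?x 1] recip_power_in_R_V_deg[OF v, where d = 1] \<psi>_recip by auto
  qed
qed

lemma Q_sub_points_iff:
  assumes f: "f \<in> Q_V_points scale n b \<iota>" and r: "corresponds_to scale n b \<iota> f r" and "0 \<in> W"
  shows "f \<in> Q_sub_points scale n b \<iota> W \<longleftrightarrow> (\<forall>v. v \<notin> W \<longrightarrow> r v = 0)"
proof -
  obtain p \<phi> where f_eq: "f = (p, \<phi>)" by fastforce
  let ?R = "subring_of_field (R_V scale n b)" and ?S = "recip scale n b ` (UNIV - W)"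
  have "ideal p ?R"
    using f unfolding f_eq Q_V_points_def Proj_points_def Proj_def
    by (auto intro: primeideal.axioms(1))
  \<comment> \<open>\<open>genideal\<close> is the intersection of all ideals containing the
    generators, and \<open>p\<close> is an ideal.\<close>
  then have "Idl\<^bsub>?R\<^esub> ?S \<subseteq> p \<longleftrightarrow> ?S \<subseteq> p"
    unfolding genideal_def by blast
  \<comment> \<open>Since \<open>0 \<in> W\<close>, each such \<open>v\<close> is nonzero, so the
    unconstrained value \<open>r 0\<close> does not enter.\<close>
  moreover have "recip scale n b v \<in> p \<longleftrightarrow> r v = 0" if "v \<notin> W" for v
    using that \<open>0 \<in> W\<close> recip_in_point_iff[of p \<phi>] f r f_eq by metis
  ultimately show ?thesis
    using f unfolding f_eq Q_sub_points_def closed_subscheme_points_def Q_ideal_def Q_V_points_def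
    by (simp add: image_subset_iff Ball_def)
qed

text \<open>If \<open>r v\<close> and \<open>r v'\<close> are nonzero, so is their product
  \<open>r (v + v') * (r v + r v')\<close>, and thus the factor \<open>r (v + v')\<close>. For
  scalars, \<open>\<iota>\<close> sends units to units. The inserted 0 covers
  \<open>v + v' = 0\<close> and \<open>c = 0\<close>.\<close>

lemma subspace_support_reciprocal_map:
  assumes "vector_space scale" "\<iota> \<in> ring_hom ring_of_type_algebra ring_of_type_algebra"
    and "reciprocal_map scale \<iota> r"
  shows "Modules.module.subspace scale (insert 0 {v. r v \<noteq> 0})"
proof -
  interpret vector_space scale by fact
  have \<iota>: "\<iota> c \<noteq> 0" if "c \<noteq> 0" for c
    using ring_hom_mult[OF assms(2), of c "inverse c"] ring_hom_one[OF assms(2)] that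
    by (auto simp: ring_of_type_algebra_def)
  have r: "\<And>v c. v \<noteq> 0 \<Longrightarrow> c \<noteq> 0 \<Longrightarrow> r (scale c v) = \<iota> (inverse c) * r v"
    "\<And>v v'. v \<noteq> 0 \<Longrightarrow> v' \<noteq> 0 \<Longrightarrow> v + v' \<noteq> 0 \<Longrightarrow> r v * r v' = r (v + v') * (r v + r v')"
    using assms(3) unfolding reciprocal_map_def by blast+
  show ?thesis
  proof (rule subspaceI)
    fix v v' assume "v \<in> insert 0 {v. r v \<noteq> 0}" "v' \<in> insert 0 {v. r v \<noteq> 0}"
    then show "v + v' \<in> insert 0 {v. r v \<noteq> 0}"
      using r(2)[of v v'] by (cases "v = 0"; cases "v' = 0") auto
  next
    fix c v assume "v \<in> insert 0 {v. r v \<noteq> 0}"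
    then show "scale c v \<in> insert 0 {v. r v \<noteq> 0}"
      using r(1)[of v c] \<iota>[of "inverse c"] by (cases "v = 0"; cases "c = 0") auto
  qed simp
qed

theorem lemma3p9:
  fixes scale :: "'k::{field,finite} \<Rightarrow> 'v::ab_group_add \<Rightarrow> 'v"
    and \<iota> :: "'k \<Rightarrow> 'l::field"
    and n :: nat
    and b :: "nat \<Rightarrow> 'v"
    and f :: "'k ratfun set \<times> ('k ratfun \<Rightarrow> 'l)"
    and r :: "'v \<Rightarrow> 'l"
    and V' :: "'v set"
  assumes "\<iota> \<in> ring_hom ring_of_type_algebra ring_of_type_algebra"
    and "algebraic_closure (ring_of_type_algebra :: 'l ring) (range \<iota>)"
    and "vector_space scale"
    and "n \<ge> 1"
    and "ordered_basis scale n b"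
    and "f \<in> Q_V_points scale n b \<iota>"
    and "reciprocal_map scale \<iota> r"
    and "\<exists>v. v \<noteq> 0 \<and> r v \<noteq> 0"
    and "corresponds_to scale n b \<iota> f r"
    and "Modules.module.subspace scale V'"
    and "V' \<noteq> {0}"
  shows "f \<in> Q_stratum_points scale n b \<iota> V' \<longleftrightarrow>
         (\<forall>v. v \<noteq> 0 \<longrightarrow> (r v = 0 \<longleftrightarrow> v \<in> UNIV - V'))"
proof -
  interpret vector_space scale by fact
  have "0 \<in> V'"
    using assms(10) by (rule subspace_0)
  have sub: "f \<in> Q_sub_points scale n b \<iota> W \<longleftrightarrow> (\<forall>v. v \<notin> W \<longrightarrow> r v = 0)" if "subspace W" for W
    using Q_sub_points_iff[OF assms(6,9) subspace_0[OF that]] .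
  define S where "S = insert 0 {v. r v \<noteq> 0}"
  have S: "subspace S" "S \<noteq> {0}"
    using subspace_support_reciprocal_map[OF assms(3,1,7)] assms(8) unfolding S_def by auto
  have sub': "f \<in> Q_sub_points scale n b \<iota> W \<longleftrightarrow> S \<subseteq> W" if "subspace W" for W
    using sub[OF that] subspace_0[OF that] unfolding S_def by blast
  \<comment> \<open>If \<open>S\<close> were strictly inside \<open>V'\<close>, it would itself be
    one of the removed \<open>W\<close>, being a subspace other than \<open>{0}\<close>. Conversely,
    no \<open>W\<close> strictly inside \<open>V' = S\<close> contains \<open>S\<close>.\<close>
  have "f \<in> Q_stratum_points scale n b \<iota> V' \<longleftrightarrow> S = V'"
    unfolding Q_stratum_points_def using sub' S assms(10) by blast
  also have "\<dots> \<longleftrightarrow> (\<forall>v. v \<noteq> 0 \<longrightarrow> (r v = 0 \<longleftrightarrow> v \<in> UNIV - V'))"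
    \<comment> \<open>Both sets contain 0, so only nonzero vectors have to be compared.\<close>
    using \<open>0 \<in> V'\<close> unfolding S_def set_eq_iff by (auto, metis)
  finally show ?thesis .
qed

end
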